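(* In the setting of the context, let $P$ be a normal height-one prime of $\mathcal A$ and set $\delta_P:=1+\eta_P$. Then for every $g\in L^*$ with $v_P(g)\neq0$, $$v_P(Dg)=v_P(g)-\delta_P .$$ For every $g\in L^*$ with $v_P(g)=0$, $v_P(Dg)\ge-\eta_P=1-\delta_P$.
   Context: All fields have characteristic $0$; $\overline F$ is an algebraic closure of $F$. $(L,D)$ is a differential field built as follows. (T1) $K_0=F(t_1,\dots,t_j)$ with $DF\subseteq F$, each $t_i$ transcendental over $F(t_1,\dots,t_{i-1})$ and $Dt_i\in F(t_1,\dots,t_i)$; $R_0=F[t_1,\dots,t_j]$. (T2) $y^m=q\in R_0$, where $q$ is $m$-th-power-free and $Y^m-q$ is irreducible over $\overline F(t_1,\dots,t_j)$. (T3) $t_{j+1},\dots,t_n$ are successively transcendental over the field below, with $Dt_i\in K_0(y)(t_{j+1},\dots,t_i)$. (T4) $L=K_0(y)(t_{j+1},\dots,t_n)$ has field of constants $F$. $\mathcal O$ is the integral closure of $R_0$ in $K_0(y)$ and $\mathcal A=\mathcal O[t_{j+1},\dots,t_n]$, which is a Krull domain (the integral closure of $F[t_1,\dots,t_n]$ in $L$). For a height-one prime $P$ of $\mathcal A$, $v_P$ is the corresponding discrete valuation of $L$ and $\mathcal A_P$ its valuation ring. Pole order: $\eta_P:=\max\bigl(0,\sup_{a\in\mathcal A\setminus\{0\}}(-v_P(Da))\bigr)$, which is finite. Choose $h\in L^*$ with $v_P(h)=\eta_P$ and put $\overline D_P:=hD$, a derivation mapping $\mathcal A_P$ into itself. Let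 $\pi$ be a uniformiser at $P$. $P$ is called special if $v_P(\overline D_P\pi)\ge1$ and normal if $v_P(\overline D_P\pi)=0$ (this does not depend on the choices of $h$ and $\pi$). *)

theory Defs
  imports "HOL-Algebra.Algebra" "HOL-Algebra.Algebraic_Closure_Type" "HOL-Library.Extended_Real"
begin

text \<open>
  The differential field \<open>L\<close> is the whole type \<open>'a\<close>, viewed as an HOL-Algebra ring through
  \<^const>\<open>ring_of_type_algebra\<close>; its subfields and subrings are subsets of \<open>'a\<close>, and a subset \<open>A\<close>
  becomes a ring of its own by restricting the carrier. Polynomials are the HOL-Algebra ones, that
  is, coefficient lists with the leading coefficient first.
\<close>

abbreviation ambient :: "'a::field ring" (\<open>\<LL>\<close>)
  where "\<LL> \<equiv> ring_of_type_algebra"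

abbreviation restricted :: "'a::field set \<Rightarrow> 'a ring"
  where "restricted A \<equiv> \<LL>\<lparr>carrier := A\<rparr>"

definition field_adjoin :: "'a::field set \<Rightarrow> 'a set \<Rightarrow> 'a set"
  where "field_adjoin K S = generate_field \<LL> (K \<union> S)"

definition ring_adjoin :: "'a::field set \<Rightarrow> 'a set \<Rightarrow> 'a set"
  where "ring_adjoin R S = generate_ring \<LL> (R \<union> S)"

definition derivation :: "('a::field \<Rightarrow> 'a) \<Rightarrow> bool"
  where "derivation D \<longleftrightarrow>
    (\<forall>x y. D (x + y) = D x + D y) \<and> (\<forall>x y. D (x * y) = D x * y + x * D y)"

definition integral_over :: "'a::field set \<Rightarrow> 'a \<Rightarrow> bool"
  where "integral_over R x \<longleftrightarrow>
    (\<exists>p \<in> carrier (univ_poly \<LL> R). p \<noteq> [] \<and> hd p = 1 \<and> ring.eval \<LL> p x = 0)"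

definition integral_closure :: "'a::field set \<Rightarrow> 'a set \<Rightarrow> 'a set"
  where "integral_closure R K = {x \<in> K. integral_over R x}"

definition power_free :: "nat \<Rightarrow> 'a::field set \<Rightarrow> 'a \<Rightarrow> bool"
  where "power_free m R q \<longleftrightarrow>
    (\<forall>p \<in> R. (p ^ m) divides\<^bsub>restricted R\<^esub> q \<longrightarrow> p \<in> Units (restricted R))"

text \<open>
  For a subfield \<open>F\<close> of \<open>'a\<close>, an algebraic closure of \<open>F\<close> is realised as the set of elements
  algebraic over \<open>F\<close> inside the algebraically closed field \<^typ>\<open>'a alg_closure\<close>, into which \<open>'a\<close>
  embeds by \<^const>\<open>to_ac\<close>.
\<close>

definition alg_closure_of :: "'a::field set \<Rightarrow> 'a alg_closure set"
  where "alg_closure_of F = {x. ring.algebraic \<LL> (to_ac ` F) x}"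

text \<open>The coefficient list of \<open>Y\<^sup>m - q\<close> (for \<open>m > 0\<close>), with coefficients in \<^typ>\<open>'a alg_closure\<close>.\<close>

definition radical_poly :: "nat \<Rightarrow> 'a::field \<Rightarrow> 'a alg_closure list"
  where "radical_poly m q = 1 # replicate (m - 1) 0 @ [- to_ac q]"

definition tower_K0 :: "'a::field set \<Rightarrow> (nat \<Rightarrow> 'a) \<Rightarrow> nat \<Rightarrow> 'a set"
  where "tower_K0 F t j = field_adjoin F (t ` {1..j})"

definition tower_R0 :: "'a::field set \<Rightarrow> (nat \<Rightarrow> 'a) \<Rightarrow> nat \<Rightarrow> 'a set"
  where "tower_R0 F t j = ring_adjoin F (t ` {1..j})"

definition tower_K0y :: "'a::field set \<Rightarrow> (nat \<Rightarrow> 'a) \<Rightarrow> nat \<Rightarrow> 'a \<Rightarrow> 'a set"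
  where "tower_K0y F t j y = field_adjoin (tower_K0 F t j) {y}"

definition tower_O :: "'a::field set \<Rightarrow> (nat \<Rightarrow> 'a) \<Rightarrow> nat \<Rightarrow> 'a \<Rightarrow> 'a set"
  where "tower_O F t j y = integral_closure (tower_R0 F t j) (tower_K0y F t j y)"

definition tower_A :: "'a::field set \<Rightarrow> (nat \<Rightarrow> 'a) \<Rightarrow> nat \<Rightarrow> nat \<Rightarrow> 'a \<Rightarrow> 'a set"
  where "tower_A F t j n y = ring_adjoin (tower_O F t j y) (t ` {j+1..n})"

text \<open>
  The generators are \<open>t 1, \<dots>, t n\<close>; the values of \<open>t\<close> at other indices play no role. The last two
  clauses say that the whole field \<open>'a\<close> is the top of the tower and that its constants are \<open>F\<close>.
\<close>

definition radical_tower ::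
  "'a::field_char_0 set \<Rightarrow> ('a \<Rightarrow> 'a) \<Rightarrow> (nat \<Rightarrow> 'a) \<Rightarrow> nat \<Rightarrow> nat \<Rightarrow> nat \<Rightarrow> 'a \<Rightarrow> 'a \<Rightarrow> bool"
  where "radical_tower F D t j n m q y \<longleftrightarrow>
    subfield F \<LL> \<and> derivation D \<and> j \<le> n \<and> 1 \<le> m \<and>
    D ` F \<subseteq> F \<and>
    (\<forall>i \<in> {1..j}. ring.transcendental \<LL> (field_adjoin F (t ` {1..<i})) (t i) \<and>
                  D (t i) \<in> field_adjoin F (t ` {1..i})) \<and>
    q \<in> tower_R0 F t j \<and> y ^ m = q \<and> power_free m (tower_R0 F t j) q \<and>
    pirreducible\<^bsub>\<LL>\<^esub> (field_adjoin (alg_closure_of F) (to_ac ` t ` {1..j})) (radical_poly m q) \<and>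
    (\<forall>i \<in> {j+1..n}.
       ring.transcendental \<LL> (field_adjoin (tower_K0y F t j y) (t ` {j+1..<i})) (t i) \<and>
       D (t i) \<in> field_adjoin (tower_K0y F t j y) (t ` {j+1..i})) \<and>
    field_adjoin (tower_K0y F t j y) (t ` {j+1..n}) = UNIV \<and>
    {x. D x = 0} = F"

definition prime_height :: "'a::field set \<Rightarrow> 'a set \<Rightarrow> enat"
  where "prime_height A P =
    Sup {enat k | k. \<exists>Q :: nat \<Rightarrow> 'a set. Q k = P \<and>
           (\<forall>i \<le> k. primeideal (Q i) (restricted A)) \<and> (\<forall>i < k. Q i \<subset> Q (Suc i))}"

definition height_one_prime :: "'a::field set \<Rightarrow> 'a set \<Rightarrow> bool"
  where "height_one_prime A P \<longleftrightarrow> primeideal P (restricted A) \<and> prime_height A P = 1"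

definition localization :: "'a::field set \<Rightarrow> 'a set \<Rightarrow> 'a set"
  where "localization A P = {a / b | a b. a \<in> A \<and> b \<in> A - P}"

text \<open>Normalised discrete valuations of the field \<open>'a\<close>, with the convention \<open>v 0 = \<infinity>\<close>.\<close>

definition discrete_valuation :: "('a::field \<Rightarrow> ereal) \<Rightarrow> bool"
  where "discrete_valuation v \<longleftrightarrow>
    v 0 = \<infinity> \<and> (\<forall>x. x \<noteq> 0 \<longrightarrow> (\<exists>k :: int. v x = ereal (of_int k))) \<and>
    (\<forall>x y. v (x * y) = v x + v y) \<and>
    (\<forall>x y. v (x + y) \<ge> min (v x) (v y)) \<and>
    (\<exists>x. v x = 1)"

text \<open>\<open>v = v\<^sub>P\<close>: the discrete valuation whose valuation ring is the local ring \<open>A\<^sub>P\<close>. There is at most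
  one, see \<open>valuation_at_unique\<close> below.\<close>

definition valuation_at :: "'a::field set \<Rightarrow> 'a set \<Rightarrow> ('a \<Rightarrow> ereal) \<Rightarrow> bool"
  where "valuation_at A P v \<longleftrightarrow> discrete_valuation v \<and> {x. v x \<ge> 0} = localization A P"

definition pole_order :: "('a::field \<Rightarrow> 'a) \<Rightarrow> 'a set \<Rightarrow> ('a \<Rightarrow> ereal) \<Rightarrow> ereal"
  where "pole_order D A v = max 0 (SUP a \<in> A - {0}. - v (D a))"

text \<open>
  Here \<open>h D\<close> is the rescaled derivation and \<open>p\<close> a uniformiser. Whether \<open>v (h * D p)\<close> is \<open>0\<close> does not
  depend on the choice of \<open>h\<close> and \<open>p\<close>. As \<open>v h\<close> is finite, a suitable \<open>h\<close> exists only because the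
  pole order, a supremum in \<^typ>\<open>ereal\<close>, is finite.
\<close>

definition normal_at :: "('a::field \<Rightarrow> 'a) \<Rightarrow> 'a set \<Rightarrow> ('a \<Rightarrow> ereal) \<Rightarrow> bool"
  where "normal_at D A v \<longleftrightarrow>
    (\<exists>h p. h \<noteq> 0 \<and> v h = pole_order D A v \<and> v p = 1 \<and> v (h * D p) = 0)"

lemma discrete_valuation_powi:
  assumes v: "discrete_valuation v" and x: "x \<noteq> 0" "v x = ereal (of_int c)"
  shows "v (x powi k) = ereal (of_int (k * c))"
proof -
  have mult: "v (y * z) = v y + v z" for y z
    using v unfolding discrete_valuation_def by blast
  obtain u :: int where u: "v 1 = ereal (of_int u)"
    using v unfolding discrete_valuation_def by (metis one_neq_zero)
  have one: "v 1 = 0" using mult[of 1 1] u by (simp add: zero_ereal_def)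
  have pow: "v (x ^ n) = ereal (of_int (int n * c))" for n
    by (induction n) (auto simp: one mult x algebra_simps)
  obtain l :: int where l: "v (x powi k) = ereal (of_int l)"
    using v x unfolding discrete_valuation_def by (metis power_int_eq_0_iff)
  show ?thesis
  proof (cases "k \<ge> 0")
    case True
    thus ?thesis using pow[of "nat k"] by (simp add: power_int_def)
  next
    case False
    hence "x powi k * x ^ nat (- k) = 1"
      using x by (simp add: power_int_def field_simps)
    hence "v (x powi k) + v (x ^ nat (- k)) = 0" using one mult by metis
    thus ?thesis using l pow[of "nat (- k)"] False by (simp add: zero_ereal_def)
  qed
qed

lemma valuation_at_unique:
  assumes v: "valuation_at A P v" and w: "valuation_at A P w"
  shows "v = w"
proof
  have dv: "discrete_valuation v" and dw: "discrete_valuation w"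
    and iff: "\<And>z. v z \<ge> 0 \<longleftrightarrow> w z \<ge> 0"
    using v w unfolding valuation_at_def by blast+
  have fin: "\<exists>k :: int. u z = ereal (of_int k)" if "discrete_valuation u" "z \<noteq> 0" for u and z :: 'a
    using that unfolding discrete_valuation_def by blast
  obtain p where p: "v p = 1" using dv unfolding discrete_valuation_def by blast
  obtain r where r: "w r = 1" using dw unfolding discrete_valuation_def by blast
  have p0: "p \<noteq> 0" and r0: "r \<noteq> 0"
    using p r dv dw unfolding discrete_valuation_def by auto
  obtain c :: int where c: "w p = ereal (of_int c)" using fin[OF dw p0] by blast
  have c0: "c \<ge> 0" using iff[of p] p c by simp
  have unit: "w z = 0" if z: "z \<noteq> 0" "v z = 0" for z
  proof -
    obtain a :: int where a: "w z = ereal (of_int a)" using fin[OF dw z(1)] by blast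
    have "v (z powi (-1)) = 0"
      using discrete_valuation_powi[OF dv z(1), of 0 "-1"] z by (simp add: zero_ereal_def)
    hence "w (z powi (-1)) \<ge> 0" using iff by (metis order_refl)
    thus ?thesis
      using discrete_valuation_powi[OF dw z(1) a, of "-1"] iff[of z] z a
      by (simp add: zero_ereal_def)
  qed
  have scale: "w x = ereal (of_int (k * c))"
    if x: "x \<noteq> 0" and k: "v x = ereal (of_int k)" for x k
  proof -
    have mult: "u (y * z) = u y + u z" if "discrete_valuation u" for u and y z :: 'a
      using that unfolding discrete_valuation_def by blast
    have "v (x * p powi (- k)) = 0"
      using mult[OF dv] discrete_valuation_powi[OF dv p0, of 1 "- k"] p k
      by (simp add: one_ereal_def zero_ereal_def)
    hence "w (x * p powi (- k)) = 0" using unit p0 x by simp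
    moreover obtain l :: int where "w x = ereal (of_int l)" using fin[OF dw x] by blast
    ultimately show ?thesis
      using mult[OF dw] discrete_valuation_powi[OF dw p0 c, of "- k"]
      by (simp add: zero_ereal_def)
  qed
  obtain b :: int where b: "v r = ereal (of_int b)" using fin[OF dv r0] by blast
  have "b * c = 1" using scale[OF r0 b] r by (simp add: one_ereal_def flip: of_int_mult)
  hence c1: "c = 1" using c0 by (simp add: zmult_eq_1_iff)
  fix x
  show "v x = w x"
  proof (cases "x = 0")
    case True
    thus ?thesis using dv dw unfolding discrete_valuation_def by simp
  next
    case False
    thus ?thesis using fin[OF dv False] scale[OF False] c1 by auto
  qed
qed

end

theory Submission
  imports Defs
begin

text \<open>
  Put \<open>e = \<eta>\<^sub>P\<close>. The quotient rule extends the bound \<open>v (D a) \<ge> -e\<close> from \<open>\<A>\<close> to the valuation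
  ring \<open>\<A>\<^sub>P\<close>, as denominators outside \<open>P\<close> are units; this settles \<open>v g = 0\<close>. Normality says that
  \<open>v (D p) = -e\<close> for a uniformiser \<open>p\<close>. If \<open>v g = k > 0\<close>, write \<open>g = p\<^sup>k u\<close> with \<open>v u = 0\<close>; then
  in \<open>D g = k p\<^bsup>k-1\<^esup> u D p + p\<^sup>k D u\<close> the first term has value \<open>k - 1 - e\<close>, because \<open>k\<close> is
  invertible in \<open>F \<subseteq> \<A>\<close>, whereas the second has value at least \<open>k - e\<close>. The case \<open>k < 0\<close> follows
  from \<open>D (1/g) = - D g / g\<^sup>2\<close>.
\<close>

section \<open>Derivations\<close>

lemma derivation_add: "derivation D \<Longrightarrow> D (x + y) = D x + D y"
  and derivation_mult: "derivation D \<Longrightarrow> D (x * y) = D x * y + x * D y"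
  unfolding derivation_def by blast+

lemma derivation_0: "derivation D \<Longrightarrow> D 0 = 0"
  using derivation_mult[of D 0 0] by simp

lemma derivation_1: "derivation D \<Longrightarrow> D 1 = 0"
  using derivation_mult[of D 1 1] by (metis add_cancel_right_right mult_1 mult_1_right)

lemma derivation_power:
  assumes "derivation D"
  shows "D (x ^ Suc n) = of_nat (Suc n) * x ^ n * D x"
  by (induction n) (simp_all add: derivation_mult[OF assms] algebra_simps)

lemma derivation_divide:
  fixes x y :: "'a::field"
  assumes D: "derivation D" and y: "y \<noteq> 0"
  shows "D (x / y) = D x / y - x * D y / (y * y)"
proof -
  have "D x = D (x / y) * y + x / y * D y"
    using derivation_mult[OF D, of "x / y" y] y by simp
  thus ?thesis using y by (simp add: field_simps)
qed

section \<open>Discrete valuations\<close>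

lemma discrete_valuation_0: "discrete_valuation v \<Longrightarrow> v 0 = \<infinity>"
  and discrete_valuation_mult: "discrete_valuation v \<Longrightarrow> v (x * y) = v x + v y"
  and discrete_valuation_add: "discrete_valuation v \<Longrightarrow> min (v x) (v y) \<le> v (x + y)"
  unfolding discrete_valuation_def by blast+

lemma discrete_valuation_finite:
  assumes "discrete_valuation v" "x \<noteq> 0"
  obtains k :: int where "v x = ereal (of_int k)"
  using assms unfolding discrete_valuation_def by blast

lemma discrete_valuation_power:
  assumes "discrete_valuation v" "x \<noteq> 0" "v x = ereal (of_int c)"
  shows "v (x ^ n) = ereal (of_int (int n * c))"
  using discrete_valuation_powi[OF assms, of "int n"] by simp

lemma discrete_valuation_1: "discrete_valuation v \<Longrightarrow> v 1 = 0"
  by (rule discrete_valuation_finite[of v 1])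
     (use discrete_valuation_power[of v 1 _ 0] in \<open>auto simp: zero_ereal_def\<close>)

lemma discrete_valuation_inverse:
  assumes "discrete_valuation v" "x \<noteq> 0"
  shows "v (inverse x) = - v x"
proof -
  obtain k where k: "v x = ereal (of_int k)"
    using discrete_valuation_finite[OF assms] .
  show ?thesis
    using discrete_valuation_powi[OF assms k, of "-1"] k by simp
qed

lemma discrete_valuation_divide:
  assumes "discrete_valuation v" "y \<noteq> 0"
  shows "v (x / y) = v x - v y"
  using discrete_valuation_mult[OF assms(1), of x "inverse y"] discrete_valuation_inverse[OF assms]
  by (simp add: divide_inverse minus_ereal_def)

text \<open>As \<open>-1\<close> squares to \<open>1\<close>, twice \<open>v (- 1)\<close> is zero,
  and finiteness makes \<open>v (- 1)\<close> itself zero.\<close>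

lemma discrete_valuation_uminus:
  assumes "discrete_valuation v"
  shows "v (- x) = v x"
proof -
  obtain k where k: "v (- 1) = ereal (of_int k)"
    using discrete_valuation_finite[OF assms, of "-1"] by auto
  have "v (- 1) + v (- 1) = 0"
    using discrete_valuation_mult[OF assms, of "-1" "-1"] discrete_valuation_1[OF assms] by simp
  hence "v (- 1) = 0" using k by (simp add: zero_ereal_def)
  thus ?thesis using discrete_valuation_mult[OF assms, of "-1" x] by simp
qed

lemma discrete_valuation_add_ge:
  assumes "discrete_valuation v" "c \<le> v x" "c \<le> v y"
  shows "c \<le> v (x + y)"
  using discrete_valuation_add[OF assms(1), of x y] assms(2,3) by (meson min.boundedI order_trans)

lemma discrete_valuation_add_eq:
  assumes v: "discrete_valuation v" and less: "v x < v y"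
  shows "v (x + y) = v x"
proof (rule antisym)
  show "v x \<le> v (x + y)"
    using discrete_valuation_add_ge[OF v] less by simp
  \<comment> \<open>Recover \<open>x\<close> as \<open>(x + y) + (- y)\<close>. Since
    \<open>v y\<close> exceeds \<open>v x\<close>, the minimum can only be
    \<open>v (x + y)\<close>.\<close>
  have "min (v (x + y)) (v y) \<le> v x"
    using discrete_valuation_add[OF v, of "x + y" "- y"] discrete_valuation_uminus[OF v, of y]
    by simp
  thus "v (x + y) \<le> v x" using less by (auto simp: min_def split: if_splits)
qed

section \<open>Derivations with bounded pole order\<close>

text \<open>Here \<open>e\<close> is a lower bound for values of derivatives, so it will be minus
  the pole order. The assumption on \<open>1\<close> places both \<open>A\<close> and the inverses
  of elements of \<open>A - P\<close> inside the localization.\<close>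

lemma valuation_derivation_localization:
  assumes D: "derivation D" and v: "discrete_valuation v"
    and loc: "{x. v x \<ge> 0} = localization A P" and one: "1 \<in> A - P"
    and bound: "\<And>a. a \<in> A \<Longrightarrow> ereal e \<le> v (D a)" and x: "v x \<ge> 0"
  shows "ereal e \<le> v (D x)"
proof -
  have int: "v a \<ge> 0" if "a \<in> A" for a
  proof -
    have "a / 1 \<in> localization A P"
      unfolding localization_def using that one by blast
    thus ?thesis using loc by auto
  qed
  obtain a b where ab: "x = a / b" "a \<in> A" "b \<in> A - P"
    using x loc unfolding localization_def by blast
  show ?thesis
  proof (cases "b = 0")
    \<comment> \<open>\<open>P\<close> is not assumed to be an ideal here, so \<open>b\<close> may
      be zero; then \<open>a / b = 0\<close> by convention, and \<open>D 0 = 0\<close> has value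
      \<infinity>.\<close>
    case True
    thus ?thesis using ab D v by (simp add: derivation_0 discrete_valuation_0)
  next
    case False
    have "1 / b \<in> localization A P"
      unfolding localization_def using ab one by blast
    hence "0 \<le> v (1 / b)" using loc by blast
    hence "0 \<le> - v b"
      using discrete_valuation_inverse[OF v False] by (simp add: inverse_eq_divide)
    moreover have "0 \<le> v b" using int ab by blast
    ultimately have b: "v b = 0" by (simp add: ereal_0_le_uminus_iff)
    have "ereal e \<le> v (D a / b)"
      using discrete_valuation_divide[OF v False] b bound[OF ab(2)] by simp
    moreover have "ereal e \<le> v (- (a * D b / (b * b)))"
    proof -
      have "v (- (a * D b / (b * b))) = v a + v (D b)"
        using False b by (simp add: discrete_valuation_uminus[OF v] discrete_valuation_divide[OF v]
            discrete_valuation_mult[OF v])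
      thus ?thesis
        using add_mono[OF int[OF ab(2)] bound[of b]] ab by simp
    qed
    ultimately have "ereal e \<le> v (D a / b + - (a * D b / (b * b)))"
      by (rule discrete_valuation_add_ge[OF v])
    thus ?thesis using ab(1) derivation_divide[OF D False] by simp
  qed
qed

text \<open>The hypothesis \<open>char\<close> makes positive integers units at \<open>v\<close>, so
  differentiating a power of \<open>p\<close> does not raise the value of the leading term. With
  \<open>e\<close> minus the pole order, \<open>e - 1\<close> is \<open>- \<delta>\<close>.\<close>

lemma valuation_derivation_normal:
  assumes D: "derivation D" and v: "discrete_valuation v"
    and char: "\<And>n. 0 < n \<Longrightarrow> v (of_nat n) = 0"
    and bound: "\<And>x. v x \<ge> 0 \<Longrightarrow> ereal e \<le> v (D x)"
    and p: "v p = 1" "v (D p) = ereal e"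
    and g: "g \<noteq> 0" "v g \<noteq> 0"
  shows "v (D g) = v g + ereal (e - 1)"
proof -
  have p0: "p \<noteq> 0" using p discrete_valuation_0[OF v] by auto
  have pow: "v (p ^ n) = ereal (real n)" for n
    using discrete_valuation_power[OF v p0, of 1 n] p by simp
  \<comment> \<open>A positive value is written \<open>Suc n\<close> so that the power rule leaves
    the exponent \<open>n\<close>.\<close>
  have pos: "v (D g) = v g + ereal (e - 1)"
    if g: "g \<noteq> 0" "v g = ereal (real (Suc n))" for g n
  proof -
    define u where "u = g / p ^ Suc n"
    have u: "v u = 0"
      unfolding u_def
      using discrete_valuation_divide[OF v, of "p ^ Suc n" g] p0 pow[of "Suc n"] g by simp
    have g_eq: "g = p ^ Suc n * u" using p0 by (simp add: u_def)
    have "D g = of_nat (Suc n) * p ^ n * D p * u + p ^ Suc n * D u"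
      unfolding g_eq derivation_mult[OF D] derivation_power[OF D] by simp
    moreover have first: "v (of_nat (Suc n) * p ^ n * D p * u) = ereal (real n + e)"
      using char[of "Suc n"] pow[of n] p u
      by (simp add: discrete_valuation_mult[OF v] del: of_nat_Suc)
    moreover have "ereal (real n + e) < v (p ^ Suc n * D u)"
    proof -
      have "ereal (real (Suc n)) + ereal e \<le> v (p ^ Suc n) + v (D u)"
        using bound[of u] u pow[of "Suc n"] by (intro add_mono) auto
      hence "ereal (real (Suc n) + e) \<le> v (p ^ Suc n * D u)"
        by (simp only: discrete_valuation_mult[OF v] plus_ereal.simps)
      thus ?thesis by (rule less_le_trans[rotated]) simp
    qed
    ultimately have "v (D g) = ereal (real n + e)"
      using discrete_valuation_add_eq[OF v] by metis
    thus ?thesis using g by simp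
  qed
  obtain k where k: "v g = ereal (of_int k)"
    using discrete_valuation_finite[OF v g(1)] .
  show ?thesis
  proof (cases "k > 0")
    case True
    hence "v g = ereal (real (Suc (nat k - 1)))" using k by simp
    thus ?thesis using pos g by blast
  next
    case False
    have "k \<noteq> 0" using g k by (auto simp: zero_ereal_def)
    hence "v (1 / g) = ereal (real (Suc (nat (- k) - 1)))"
      using False k discrete_valuation_inverse[OF v g(1)] by (simp add: inverse_eq_divide)
    hence "v (D (1 / g)) = v (1 / g) + ereal (e - 1)"
      using pos[of "1 / g"] g by auto
    moreover have "D (1 / g) = - (D g / (g * g))"
      using derivation_divide[OF D g(1), of 1] derivation_1[OF D] by simp
    \<comment> \<open>The right side is finite, hence so is \<open>v (D g)\<close>, and solving for
      it yields \<open>k + (e - 1)\<close>.\<close>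
    ultimately have "v (D g) - (v g + v g) = v (1 / g) + ereal (e - 1)"
      using g discrete_valuation_divide[OF v]
      by (simp add: discrete_valuation_uminus[OF v] discrete_valuation_mult[OF v])
    moreover have "v (1 / g) = ereal (- of_int k)"
      using k discrete_valuation_inverse[OF v g(1)] by (simp add: inverse_eq_divide)
    ultimately show ?thesis using k by (cases "v (D g)") auto
  qed
qed

section \<open>The base field inside the tower\<close>

lemma ambient_simps:
  "carrier \<LL> = UNIV" "x \<otimes>\<^bsub>\<LL>\<^esub> y = x * y" "x \<oplus>\<^bsub>\<LL>\<^esub> y = x + y" "\<one>\<^bsub>\<LL>\<^esub> = 1" "\<zero>\<^bsub>\<LL>\<^esub> = 0"
  by (simp_all add: ring_of_type_algebra_def)

lemma ambient_a_inv: "\<ominus>\<^bsub>\<LL>\<^esub> x = - (x :: 'a::field)"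
proof -
  interpret ring "\<LL> :: 'a ring" by (rule ring_from_type_algebra)
  show ?thesis by (rule minus_equality) (simp_all add: ambient_simps)
qed

lemma ambient_m_inv:
  fixes x :: "'a::field"
  assumes "x \<noteq> 0"
  shows "inv\<^bsub>\<LL>\<^esub> x = inverse x"
proof -
  interpret cring "\<LL> :: 'a ring" by (rule cring_from_type_algebra)
  show ?thesis by (rule comm_inv_char) (use assms in \<open>simp_all add: ambient_simps\<close>)
qed

lemma of_nat_in_subfield:
  assumes "subfield F (\<LL> :: 'a::field ring)"
  shows "of_nat n \<in> F"
proof (induction n)
  case 0
  show ?case
    using subringE(2)[OF subfieldE(1)[OF assms]] by (simp add: ambient_simps)
next
  case (Suc n)
  show ?case
    using subringE(7)[OF subfieldE(1)[OF assms] subringE(3)[OF subfieldE(1)[OF assms]] Suc]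
    by (simp add: ambient_simps)
qed

lemma inverse_in_subfield:
  assumes "subfield F (\<LL> :: 'a::field ring)" "x \<in> F" "x \<noteq> 0"
  shows "inverse x \<in> F"
proof -
  interpret field "\<LL> :: 'a ring" by (rule field_from_type_algebra)
  show ?thesis
    using subfield_m_inv(1)[OF assms(1), of x] assms(2,3)
    by (simp add: ambient_simps ambient_m_inv)
qed

lemma ring_adjoin_superset: "R \<subseteq> ring_adjoin R S"
  unfolding ring_adjoin_def by (auto intro: generate_ring.incl)

lemma field_adjoin_superset: "K \<subseteq> field_adjoin K S"
  unfolding field_adjoin_def by (auto intro: generate_field.incl)

lemma one_in_ring_adjoin: "1 \<in> ring_adjoin R S"
  unfolding ring_adjoin_def using generate_ring.one[of "\<LL>"] by (simp add: ambient_simps)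

lemma uminus_in_ring_adjoin: "x \<in> ring_adjoin R S \<Longrightarrow> - x \<in> ring_adjoin R S"
  unfolding ring_adjoin_def using generate_ring.a_inv[of x "\<LL>"] by (simp add: ambient_a_inv)

text \<open>The witness is the monic linear polynomial \<open>X - x\<close>.\<close>

lemma integral_over_self:
  fixes x :: "'a::field"
  assumes "1 \<in> R" "- x \<in> R"
  shows "integral_over R x"
proof -
  interpret ring "\<LL> :: 'a ring" by (rule ring_from_type_algebra)
  have "[1, - x] \<in> carrier (univ_poly \<LL> R)"
    using assms by (simp add: univ_poly_carrier[symmetric] polynomial_def ambient_simps)
  moreover have "ring.eval \<LL> [1, - x] x = 0"
    by (simp add: ambient_simps)
  ultimately show ?thesis
    unfolding integral_over_def by force
qed

text \<open>Serves to show that nonzero rational integers are units at \<open>v\<close>: they and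
  their inverses lie in \<open>F\<close>.\<close>

lemma base_field_subset_tower_A: "F \<subseteq> tower_A F t j n y"
proof
  fix x assume x: "x \<in> F"
  hence R: "x \<in> tower_R0 F t j"
    unfolding tower_R0_def using ring_adjoin_superset by blast
  hence "integral_over (tower_R0 F t j) x"
    unfolding tower_R0_def
    by (intro integral_over_self one_in_ring_adjoin uminus_in_ring_adjoin)
  moreover have "x \<in> tower_K0y F t j y"
    unfolding tower_K0y_def tower_K0_def using x field_adjoin_superset by blast
  ultimately have "x \<in> tower_O F t j y"
    unfolding tower_O_def integral_closure_def by blast
  thus "x \<in> tower_A F t j n y"
    unfolding tower_A_def using ring_adjoin_superset by blast
qed

lemma primeideal_one_notin:
  assumes "primeideal P (restricted A)"
  shows "1 \<notin> P"
proof
  interpret primeideal P "restricted A" by (rule assms)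
  assume "1 \<in> P"
  hence "carrier (restricted A) = P"
    using one_imp_carrier by (simp add: ambient_simps)
  thus False using I_notcarr by simp
qed

theorem theorem4p5:
  fixes F :: "'a::field_char_0 set" and D :: "'a \<Rightarrow> 'a" and t :: "nat \<Rightarrow> 'a"
    and j n m :: nat and q y :: 'a and P :: "'a set" and v :: "'a \<Rightarrow> ereal" and \<delta> :: ereal
  assumes "radical_tower F D t j n m q y"
    and "height_one_prime (tower_A F t j n y) P"
    and "valuation_at (tower_A F t j n y) P v"
    and "normal_at D (tower_A F t j n y) v"
    and "\<delta> = 1 + pole_order D (tower_A F t j n y) v"
  shows "(\<forall>g. g \<noteq> 0 \<and> v g \<noteq> 0 \<longrightarrow> v (D g) = v g - \<delta>) \<and>
         (\<forall>g. g \<noteq> 0 \<and> v g = 0 \<longrightarrow>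
              v (D g) \<ge> - pole_order D (tower_A F t j n y) v \<and>
              - pole_order D (tower_A F t j n y) v = 1 - \<delta>)"
proof -
  define A where "A = tower_A F t j n y"
  have F: "subfield F \<LL>" and D: "derivation D"
    using assms(1) unfolding radical_tower_def by blast+
  have v: "discrete_valuation v" and loc: "{x. v x \<ge> 0} = localization A P"
    using assms(3) unfolding valuation_at_def A_def by blast+
  obtain h p where h: "h \<noteq> 0" "v h = pole_order D A v" and p: "v p = 1" "v (h * D p) = 0"
    using assms(4) unfolding normal_at_def A_def by blast
  obtain k where k: "v h = ereal (of_int k)"
    using discrete_valuation_finite[OF v h(1)] .
  \<comment> \<open>The sign is opposite to the overview: this \<open>e\<close> is
    \<open>- \<eta>\<^sub>P\<close>. It is real because \<open>h\<close> is nonzero and so has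
    finite value.\<close>
  define e where "e = - real_of_int k"
  have eta: "pole_order D A v = ereal (- e)" using h k by (simp add: e_def)
  have one: "1 \<in> A - P"
    using assms(2) primeideal_one_notin one_in_ring_adjoin
    unfolding height_one_prime_def A_def tower_A_def by blast
  have bound_A: "ereal e \<le> v (D a)" if "a \<in> A" for a
  \<comment> \<open>Zero is left out of the supremum defining the pole order, but
    \<open>D 0 = 0\<close> has value \<infinity>.\<close>
  proof (cases "a = 0")
    case True
    thus ?thesis using D v by (simp add: derivation_0 discrete_valuation_0)
  next
    case False
    have "- v (D a) \<le> (SUP a \<in> A - {0}. - v (D a))"
      using that False by (intro SUP_upper) auto
    also have "\<dots> \<le> pole_order D A v" unfolding pole_order_def by simp
    finally show ?thesis unfolding eta by (cases "v (D a)") auto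
  qed
  have bound: "ereal e \<le> v (D x)" if "v x \<ge> 0" for x
    by (rule valuation_derivation_localization[OF D v loc one bound_A that])
  have char: "v (of_nat i) = 0" if "0 < i" for i
  proof -
    have int: "0 \<le> v x" if "x \<in> F" for x
    proof -
      have "x / 1 \<in> localization A P"
        unfolding localization_def
        using that one base_field_subset_tower_A[of F t j n y] A_def by blast
      thus ?thesis using loc by auto
    qed
    have "of_nat i \<noteq> (0::'a)" using that by simp
    \<comment> \<open>The second inequality is the first one for the inverse of
      \<open>of_nat i\<close>, which also lies in \<open>F\<close>.\<close>
    hence "0 \<le> v (of_nat i)" "0 \<le> - v (of_nat i)"
      using int of_nat_in_subfield[OF F] inverse_in_subfield[OF F]
        discrete_valuation_inverse[OF v] by metis+
    thus ?thesis by (simp add: ereal_0_le_uminus_iff)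
  qed
  \<comment> \<open>Normality reads \<open>v h + v (D p) = 0\<close> with \<open>v h = k\<close>, so
    the bound \<open>e\<close> is attained at \<open>p\<close>.\<close>
  have Dp: "v (D p) = ereal e"
    using p(2) k discrete_valuation_mult[OF v, of h "D p"]
    by (cases "v (D p)") (auto simp: e_def)
  have delta: "\<delta> = ereal (1 - e)"
    using assms(5) eta by (simp add: A_def one_ereal_def)
  have "v (D g) = v g - \<delta>" if "g \<noteq> 0" "v g \<noteq> 0" for g
    using valuation_derivation_normal[OF D v char bound p(1) Dp that]
    by (simp add: delta minus_ereal_def)
  moreover have "v (D g) \<ge> - pole_order D A v" if "v g = 0" for g
    using bound[of g] that eta by simp
  moreover have "- pole_order D A v = 1 - \<delta>"
    using eta delta by (simp add: one_ereal_def)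
  ultimately show ?thesis unfolding A_def by blast
qed

end
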